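(* Let $p>1$ and let $f,g,\rho,d$ satisfy the standing assumptions. Assume that $d(u)\sim k_1(1-u)^\delta$ and $\rho(u)\sim k_2(1-u)^r$ as $u\to1^-$, for some positive constants $k_1,k_2,r$ and $\delta\in\mathbb R$ satisfying $$r(p-1)+\delta+p>1.$$ Let $u$ be a traveling wave solution having speed $c$, defined in $(\alpha,\beta)$. Then: (a) if $r(p-1)+\delta=1$, we have $\alpha>-\infty$ if and only if $p+\delta>2$; (b) if $r(p-1)+\delta>1$ and $cg(1)<f(1)$, we have $\alpha>-\infty$ if and only if $p+\delta>2$; (c) if $r(p-1)+\delta>1$ and $cg(1)>f(1)$, we have $\alpha>-\infty$ if and only if $r<1$; (d) if $r(p-1)+\delta>1$, $cg(1)=f(1)$ and $r<1$, we have $\alpha>-\infty$; (e) if $r(p-1)+\delta<1$, we have $\alpha>-\infty$ if and only if $p+\delta>r+1$. Moreover, when $\alpha>-\infty$: - if $\delta<1$, then $u'(\alpha^+)=0$; - if $\delta=1$, then $u'(\alpha^+)=0$ if and only if $cg(1)-f(1)\ge0$; - if $\delta>1$ and $cg(1)>f(1)$, then $u'(\alpha^+)=0$; - if $\delta>1$ and $cg(1)<f(1)$, then $u'(\alpha^+)=-\infty$.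
   Context: Standing assumptions: $p>1$; $f,g,\rho\in C[0,1]$; $d\in C^1(0,1)$; $\rho(u)>0$ in $(0,1)$ and $\rho(0)=\rho(1)=0$; $g(0)>0$ and $\int_0^u g(s)\,ds>0$ for every $u\in(0,1]$; $d(u)>0$ in $(0,1)$ and $\rho\, d^{\frac1{p-1}}\in L^1(0,1)$. A traveling wave solution (t.w.s.) with speed $c\in\mathbb R$ is a function $u\in C^1(\alpha,\beta)$, with $-\infty\le\alpha<\beta\le+\infty$, such that $0<u(t)<1$ for all $t\in(\alpha,\beta)$, $d(u)|u'|^{p-2}u'\in C^1(\alpha,\beta)$, $$(d(u)|u'|^{p-2}u')'+(cg(u)-f(u))u'+\rho(u)=0\quad\text{in }(\alpha,\beta),$$ $u(\alpha^+)=1$, $u(\beta^-)=0$, and $\lim_{t\to\alpha^+}d(u)|u'|^{p-2}u'=\lim_{t\to\beta^-}d(u)|u'|^{p-2}u'=0$. $a\sim b$ means that $a/b\to1$; $u'(\alpha^+)=\lim_{t\to\alpha^+}u'(t)$. *)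

theory Defs
  imports "HOL-Analysis.Analysis" "HOL-Library.Landau_Symbols"
begin

definition standing_assumptions ::
  "real \<Rightarrow> (real \<Rightarrow> real) \<Rightarrow> (real \<Rightarrow> real) \<Rightarrow> (real \<Rightarrow> real) \<Rightarrow> (real \<Rightarrow> real) \<Rightarrow> bool" where
  "standing_assumptions p f g \<rho> d \<longleftrightarrow>
     p > 1 \<and>
     continuous_on {0..1} f \<and> continuous_on {0..1} g \<and> continuous_on {0..1} \<rho> \<and>
     d C1_differentiable_on {0<..<1} \<and>
     (\<forall>u\<in>{0<..<1}. \<rho> u > 0) \<and> \<rho> 0 = 0 \<and> \<rho> 1 = 0 \<and>
     g 0 > 0 \<and> (\<forall>u\<in>{0<..1}. integral {0..u} g > 0) \<and>
     (\<forall>u\<in>{0<..<1}. d u > 0) \<and>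
     set_integrable lborel {0<..<1} (\<lambda>u. \<rho> u * d u powr (1 / (p - 1)))"

text \<open>
  The flux \<open>d(u) |u'|\<^sup>p\<^sup>-\<^sup>2 u'\<close>. Since \<open>0 powr a = 0\<close> for every \<open>a\<close>, it vanishes where
  \<open>u' = 0\<close>, which is the intended value also for \<open>1 < p \<le> 2\<close>.
\<close>

definition flux :: "real \<Rightarrow> (real \<Rightarrow> real) \<Rightarrow> (real \<Rightarrow> real) \<Rightarrow> real \<Rightarrow> real" where
  "flux p d u t = d (u t) * \<bar>deriv u t\<bar> powr (p - 2) * deriv u t"

text \<open>
  The end points \<open>\<alpha>\<close> and \<open>\<beta>\<close> may be infinite. One-sided limits at them are taken in \<^typ>\<open>ereal\<close>,
  so that \<^term>\<open>at_right (-\<infinity>::ereal)\<close> stands for \<open>t \<rightarrow> -\<infinity>\<close> and \<^term>\<open>at_left (\<infinity>::ereal)\<close>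
  for \<open>t \<rightarrow> \<infinity>\<close>. Only the values of \<open>u\<close> on the open interval matter.
\<close>

definition traveling_wave ::
  "real \<Rightarrow> (real \<Rightarrow> real) \<Rightarrow> (real \<Rightarrow> real) \<Rightarrow> (real \<Rightarrow> real) \<Rightarrow> (real \<Rightarrow> real) \<Rightarrow> real \<Rightarrow>
   ereal \<Rightarrow> ereal \<Rightarrow> (real \<Rightarrow> real) \<Rightarrow> bool" where
  "traveling_wave p f g \<rho> d c \<alpha> \<beta> u \<longleftrightarrow>
     \<alpha> < \<beta> \<and>
     u C1_differentiable_on einterval \<alpha> \<beta> \<and>
     (\<forall>t\<in>einterval \<alpha> \<beta>. 0 < u t \<and> u t < 1) \<and>
     flux p d u C1_differentiable_on einterval \<alpha> \<beta> \<and>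
     (\<forall>t\<in>einterval \<alpha> \<beta>.
        deriv (flux p d u) t + (c * g (u t) - f (u t)) * deriv u t + \<rho> (u t) = 0) \<and>
     ((u \<circ> real_of_ereal) \<longlongrightarrow> 1) (at_right \<alpha>) \<and>
     ((u \<circ> real_of_ereal) \<longlongrightarrow> 0) (at_left \<beta>) \<and>
     ((flux p d u \<circ> real_of_ereal) \<longlongrightarrow> 0) (at_right \<alpha>) \<and>
     ((flux p d u \<circ> real_of_ereal) \<longlongrightarrow> 0) (at_left \<beta>)"

end

(* Near alpha put x = 1 - u, v = -u' and w = - d(u) |u'|^(p-2) u'. At a zero of the flux its
   derivative is -rho(u) < 0, so the flux vanishes at most once, from positive to negative; being
   positive near alpha would make u increase away from its limit 1, so w > 0 throughout. With
   a = 1/(p-1), R = rho(u) d(u)^a and h = f(u) - c g(u) the equation reads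
   w' = v (h + R / w^a) with v = x' = (w / d(u))^a; that is, dw/dx = h + R / w^a, where R behaves
   like x^sigma with sigma = r + a delta. Comparison with the functions C x^m bounds w above and
   below by multiples of x^m, with m = (sigma+1)/(a+1) if sigma <= a, and, if sigma > a, with m = 1
   when h(alpha+) > 0 and m = sigma/a when h(alpha+) < 0. So x' behaves like x^s with
   s = a (m - delta), x reaches 0 in finite time iff s < 1, and the limits of v = -u' follow. *)
theory Submission
  imports Defs
begin

section \<open>Left end points, finite or infinite\<close>

text \<open>Pushing the filter down to the reals lets a finite \<alpha> and \<alpha> = -\<infinity>
  share one argument, for functions of a real variable.\<close>

definition at_right_end :: "ereal \<Rightarrow> real filter" where
  "at_right_end \<alpha> = filtermap real_of_ereal (at_right \<alpha>)"

lemma at_right_end_simps: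
  "at_right_end (ereal a) = at_right a" "at_right_end (-\<infinity>) = at_bot"
  by (simp_all add: at_right_end_def at_right_ereal at_right_MInf filtermap_filtermap)

lemma eventually_at_right_end:
  assumes "\<alpha> < \<infinity>"
  shows "eventually P (at_right_end \<alpha>) \<longleftrightarrow>
    (\<exists>b. \<alpha> < ereal b \<and> (\<forall>t. \<alpha> < ereal t \<and> t < b \<longrightarrow> P t))"
  using assms
  by (cases \<alpha>) (auto simp: at_right_end_simps eventually_at_right_field eventually_at_bot_dense)

lemma at_right_end_neq_bot: "\<alpha> < \<infinity> \<Longrightarrow> at_right_end \<alpha> \<noteq> bot"
  by (cases \<alpha>) (auto simp: at_right_end_simps)

lemma filterlim_at_right_end_iff:
  "filterlim (f \<circ> real_of_ereal) G (at_right \<alpha>) \<longleftrightarrow> filterlim f G (at_right_end \<alpha>)"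
  by (simp add: at_right_end_def filterlim_def filtermap_filtermap comp_def)

lemma eventually_einterval_at_right_end:
  assumes "\<alpha> < \<beta>"
  shows "\<forall>\<^sub>F t in at_right_end \<alpha>. t \<in> einterval \<alpha> \<beta>"
proof -
  obtain b where "\<alpha> < ereal b" "ereal b < \<beta>"
    using ereal_dense2[OF assms] by blast
  moreover have "\<alpha> < \<infinity>" using assms by (cases \<alpha>) auto
  ultimately show ?thesis
    unfolding eventually_at_right_end[OF \<open>\<alpha> < \<infinity>\<close>]
    by (intro exI[of _ b]) (auto simp: einterval_iff intro: less_trans[of _ "ereal b"])
qed

section \<open>Comparison at the end point\<close>

text \<open>Going left from a point where \<open>G\<close> is positive, \<open>G\<close> cannot drop
  as long as it stays positive. So it keeps at least its value at that point and cannot tend to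
  0.\<close>

lemma nonpos_near_right_end:
  fixes G G' :: "real \<Rightarrow> real"
  assumes "\<alpha> < \<infinity>"
    and deriv: "\<forall>\<^sub>F t in at_right_end \<alpha>. (G has_real_derivative G' t) (at t)"
    and lim: "(G \<longlongrightarrow> 0) (at_right_end \<alpha>)"
    and decr: "\<forall>\<^sub>F t in at_right_end \<alpha>. G t > 0 \<longrightarrow> G' t \<le> 0"
  shows "\<forall>\<^sub>F t in at_right_end \<alpha>. G t \<le> 0"
proof -
  obtain b where b: "\<alpha> < ereal b"
    and D: "\<And>t. \<alpha> < ereal t \<Longrightarrow> t < b \<Longrightarrow> (G has_real_derivative G' t) (at t)"
    and N: "\<And>t. \<alpha> < ereal t \<Longrightarrow> t < b \<Longrightarrow> G t > 0 \<Longrightarrow> G' t \<le> 0"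
    using eventually_conj[OF deriv decr] unfolding eventually_at_right_end[OF assms(1)] by blast
  have "G t1 \<le> 0" if t1: "\<alpha> < ereal t1" "t1 < b" for t1
  proof (rule ccontr)
    assume "\<not> G t1 \<le> 0"
    then have pos: "G t1 > 0" by simp
    have ge: "G t1 \<le> G t0" if t0: "\<alpha> < ereal t0" "t0 < t1" for t0
    proof (rule ccontr)
      assume "\<not> G t1 \<le> G t0"
      \<comment> \<open>The level \<open>y\<close> is nonnegative and below \<open>G t1\<close>.
        Right of the last point \<open>s\<close> with \<open>G s \<le> y\<close>, \<open>G\<close>
        is positive, hence nonincreasing, and \<open>G t1 \<le> y\<close> follows, a
        contradiction.\<close>
      define y where "y = max 0 (G t0)"
      have y: "y < G t1" "0 \<le> y" "G t0 \<le> y" using pos \<open>\<not> G t1 \<le> G t0\<close> by (auto simp: y_def)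
      have \<alpha>t: "\<alpha> < ereal t" if "t0 \<le> t" for t
        using t0(1) that by (meson ereal_less_eq(3) less_le_trans)
      have cont: "continuous_on {t0..t1} G"
      proof (rule DERIV_continuous_on)
        fix t assume "t \<in> {t0..t1}"
        then show "(G has_real_derivative G' t) (at t within {t0..t1})"
          using D[of t] \<alpha>t[of t] t1(2) has_field_derivative_at_within by fastforce
      qed
      define S where "S = {t0..t1} \<inter> G -` {..y}"
      have "compact S"
        unfolding S_def using continuous_on_closed_vimage[of "{t0..t1}" G] cont
        by (metis Int_commute bounded_Int bounded_closed_interval closed_atLeastAtMost closed_atMost
            compact_eq_bounded_closed)
      moreover have "t0 \<in> S" using y t0 by (auto simp: S_def)
      ultimately obtain s where s: "s \<in> S" "\<And>t. t \<in> S \<Longrightarrow> t \<le> s"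
        using compact_attains_sup[of S] by blast
      have st: "s < t1" "t0 \<le> s" "G s \<le> y" using s(1) y by (auto simp: S_def order.order_iff_strict)
      have "G t1 \<le> G s"
      proof (rule DERIV_nonpos_imp_decreasing_open[of s t1 G])
        show "s \<le> t1" using st by simp
        show "continuous_on {s..t1} G" using cont st by (auto intro: continuous_on_subset)
        fix t assume t: "s < t" "t < t1"
        then have "t \<notin> S" using s(2) by force
        then have "G t > 0" using t st y by (auto simp: S_def)
        then show "\<exists>z. (G has_real_derivative z) (at t) \<and> z \<le> 0"
          using D[of t] N[of t] \<alpha>t[of t] t st t1 by force
      qed
      with st y show False by simp
    qed
    have "\<forall>\<^sub>F t in at_right_end \<alpha>. G t < G t1"
      using order_tendstoD(2)[OF lim pos] .
    moreover have "\<forall>\<^sub>F t in at_right_end \<alpha>. G t1 \<le> G t"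
      unfolding eventually_at_right_end[OF assms(1)] using ge t1(1) by blast
    ultimately have "\<forall>\<^sub>F t in at_right_end \<alpha>. False" by eventually_elim simp
    then show False using at_right_end_neq_bot[OF assms(1)] by (simp add: trivial_limit_def)
  qed
  then show ?thesis unfolding eventually_at_right_end[OF assms(1)] using b by blast
qed

section \<open>Constants for the barriers\<close>

text \<open>A small factor \<open>C\<close> makes the source term of a lower barrier dominate
  bounded terms.\<close>

lemma powr_minus_large:
  fixes A k a :: real
  assumes "k > 0" "a > 0"
  obtains C where "0 < C" "C \<le> 1" "A \<le> k * C powr (-a)"
proof
  \<comment> \<open>The witness \<open>B powr (- (1 / a))\<close> has \<open>B\<close> as its power
    with exponent \<open>-a\<close>; \<open>B \<ge> 1\<close> keeps it at most 1.\<close>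
  define B where "B = max 1 (A / k)"
  have B: "B \<ge> 1" "A / k \<le> B" by (auto simp: B_def)
  show "0 < B powr (- (1 / a))" using B by auto
  show "B powr (- (1 / a)) \<le> 1" using B assms powr_mono[of "-(1/a)" 0 B] by auto
  show "A \<le> k * (B powr (- (1 / a))) powr (-a)"
    using B assms by (simp add: powr_powr field_simps)
qed

text \<open>A large factor \<open>C\<close> makes the source term of an upper barrier small enough
  to be beaten by a negative drift.\<close>

lemma powr_minus_small:
  fixes K e a :: real
  assumes "e > 0" "a > 0"
  obtains C where "1 \<le> C" "K * C powr (-a) \<le> e"
proof
  define B where "B = max 1 (K / e)"
  have B: "B \<ge> 1" "K / e \<le> B" by (auto simp: B_def)
  show "1 \<le> B powr (1 / a)" using B assms by (simp add: ge_one_powr_ge_zero)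
  show "K * (B powr (1 / a)) powr (-a) \<le> e"
    using B assms by (simp add: powr_powr powr_minus field_simps)
qed

section \<open>The equation near the end point\<close>

text \<open>Of the asymptotics of \<open>R\<close> and \<open>d\<close> only two-sided power bounds
  are kept, since orders of magnitude decide the results. Everything is required only near
  \<alpha>.\<close>

locale wave_end =
  fixes \<alpha> :: ereal and x v w h d R :: "real \<Rightarrow> real"
    and a \<delta> \<sigma> k k' l l' h0 :: real
  assumes \<alpha>: "\<alpha> < \<infinity>"
    and deriv_x: "\<forall>\<^sub>F t in at_right_end \<alpha>. (x has_real_derivative v t) (at t)"
    and deriv_w: "\<forall>\<^sub>F t in at_right_end \<alpha>.
      (w has_real_derivative v t * (h t + R t / w t powr a)) (at t)"
    and x_pos: "\<forall>\<^sub>F t in at_right_end \<alpha>. 0 < x t"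
    and w_pos: "\<forall>\<^sub>F t in at_right_end \<alpha>. 0 < w t"
    and v_eq: "\<forall>\<^sub>F t in at_right_end \<alpha>. v t = (w t / d t) powr a"
    and R_ge: "\<forall>\<^sub>F t in at_right_end \<alpha>. k * x t powr \<sigma> \<le> R t"
    and R_le: "\<forall>\<^sub>F t in at_right_end \<alpha>. R t \<le> k' * x t powr \<sigma>"
    and d_ge: "\<forall>\<^sub>F t in at_right_end \<alpha>. l * x t powr \<delta> \<le> d t"
    and d_le: "\<forall>\<^sub>F t in at_right_end \<alpha>. d t \<le> l' * x t powr \<delta>"
    and x_lim: "(x \<longlongrightarrow> 0) (at_right_end \<alpha>)"
    and w_lim: "(w \<longlongrightarrow> 0) (at_right_end \<alpha>)"
    and h_lim: "(h \<longlongrightarrow> h0) (at_right_end \<alpha>)"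
    and a_pos: "a > 0" and \<sigma>: "\<sigma> > -1" and k_pos: "k > 0" and l_pos: "l > 0"
begin

lemma x_less: "e > 0 \<Longrightarrow> \<forall>\<^sub>F t in at_right_end \<alpha>. x t < e"
  using order_tendstoD(2)[OF x_lim] .

lemma x_powr_lim: "m > 0 \<Longrightarrow> ((\<lambda>t. x t powr m) \<longlongrightarrow> 0) (at_right_end \<alpha>)"
  using x_pos by (intro tendsto_zero_powrI[OF x_lim tendsto_const]) (auto elim: eventually_mono)

text \<open>With \<open>v = x'\<close> factored out, the bracket compares slopes in the variable
  \<open>x\<close>; as \<open>v\<close> is nonnegative, the bracket controls the sign.\<close>

lemma deriv_gap:
  "\<forall>\<^sub>F t in at_right_end \<alpha>. ((\<lambda>t. w t - C * x t powr m) has_real_derivative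
     v t * (h t + R t / w t powr a - C * m * x t powr (m - 1))) (at t)"
  using deriv_x deriv_w x_pos
proof eventually_elim
  case (elim t)
  show ?case
    by (rule derivative_eq_intros elim refl)+ (simp add: algebra_simps)
qed

lemma gap_lim: "m > 0 \<Longrightarrow> ((\<lambda>t. w t - C * x t powr m) \<longlongrightarrow> 0) (at_right_end \<alpha>)"
  using tendsto_diff[OF w_lim tendsto_mult_left[OF x_powr_lim, of m C]] by simp

text \<open>\<open>super\<close> makes \<open>C x^m\<close> a supersolution of
  \<open>dw/dx = h + R / w^a\<close>. Where \<open>w\<close> lies above it, \<open>R / w^a\<close>
  is at most its bound on the barrier because \<open>a > 0\<close>, so the gap does not increase in
  \<open>t\<close> and the comparison applies.\<close>

lemma w_le_power:
  assumes "C > 0" "m > 0"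
    and super: "\<forall>\<^sub>F t in at_right_end \<alpha>.
      h t + k' * C powr (-a) * x t powr (\<sigma> - a * m) \<le> C * m * x t powr (m - 1)"
  shows "\<forall>\<^sub>F t in at_right_end \<alpha>. w t \<le> C * x t powr m"
proof -
  have "\<forall>\<^sub>F t in at_right_end \<alpha>. w t - C * x t powr m > 0 \<longrightarrow>
     v t * (h t + R t / w t powr a - C * m * x t powr (m - 1)) \<le> 0"
    using super R_ge R_le x_pos v_eq w_pos
  proof eventually_elim
    case (elim t)
    show ?case
    proof
      assume less: "w t - C * x t powr m > 0"
      have "R t / w t powr a \<le> k' * x t powr \<sigma> / w t powr a"
        using elim by (intro divide_right_mono) auto
      also have "\<dots> \<le> k' * x t powr \<sigma> / (C * x t powr m) powr a"
      proof (intro divide_left_mono)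
        show "(C * x t powr m) powr a \<le> w t powr a"
          using less assms elim a_pos by (intro powr_mono2) auto
        \<comment> \<open>The sign of \<open>k'\<close> is not assumed; the two bounds on
          \<open>R\<close> give it here.\<close>
        have "0 \<le> k * x t powr \<sigma>" using k_pos by simp
        then show "0 \<le> k' * x t powr \<sigma>" using elim by linarith
      qed (use assms elim in auto)
      also have "\<dots> = k' * C powr (-a) * x t powr (\<sigma> - a * m)"
        using elim assms by (simp add: powr_mult powr_powr powr_diff powr_minus field_simps)
      finally have "h t + R t / w t powr a - C * m * x t powr (m - 1) \<le> 0" using elim by simp
      moreover have "v t \<ge> 0" using elim by simp
      ultimately show "v t * (h t + R t / w t powr a - C * m * x t powr (m - 1)) \<le> 0"
        by (rule mult_nonneg_nonpos[rotated])
    qed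
  qed
  from nonpos_near_right_end[OF \<alpha> deriv_gap gap_lim this] assms show ?thesis by simp
qed

text \<open>Mirror image for a subsolution: below the barrier the singular term is at least its
  value on the barrier, so the negated gap does not increase.\<close>

lemma w_ge_power:
  assumes "C > 0" "m > 0"
    and sub: "\<forall>\<^sub>F t in at_right_end \<alpha>.
      C * m * x t powr (m - 1) \<le> h t + k * C powr (-a) * x t powr (\<sigma> - a * m)"
  shows "\<forall>\<^sub>F t in at_right_end \<alpha>. C * x t powr m \<le> w t"
proof -
  have "\<forall>\<^sub>F t in at_right_end \<alpha>. - (w t - C * x t powr m) > 0 \<longrightarrow>
     - (v t * (h t + R t / w t powr a - C * m * x t powr (m - 1))) \<le> 0"
    using sub R_ge x_pos v_eq w_pos
  proof eventually_elim
    case (elim t)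
    show ?case
    proof
      assume less: "- (w t - C * x t powr m) > 0"
      have "k * C powr (-a) * x t powr (\<sigma> - a * m) = k * x t powr \<sigma> / (C * x t powr m) powr a"
        using elim assms by (simp add: powr_mult powr_powr powr_diff powr_minus field_simps)
      also have "\<dots> \<le> k * x t powr \<sigma> / w t powr a"
      proof (intro divide_left_mono)
        show "w t powr a \<le> (C * x t powr m) powr a"
          using less assms elim a_pos by (intro powr_mono2) auto
      qed (use assms elim k_pos in auto)
      also have "\<dots> \<le> R t / w t powr a"
        using elim by (intro divide_right_mono) auto
      finally have "0 \<le> h t + R t / w t powr a - C * m * x t powr (m - 1)" using elim by simp
      moreover have "v t \<ge> 0" using elim by simp
      ultimately show "- (v t * (h t + R t / w t powr a - C * m * x t powr (m - 1))) \<le> 0"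
        by simp
    qed
  qed
  note decr = this
  have deriv: "\<forall>\<^sub>F t in at_right_end \<alpha>. ((\<lambda>t. - (w t - C * x t powr m)) has_real_derivative
     - (v t * (h t + R t / w t powr a - C * m * x t powr (m - 1)))) (at t)"
    using deriv_gap[of C m] by eventually_elim (rule DERIV_minus)
  have lim: "((\<lambda>t. - (w t - C * x t powr m)) \<longlongrightarrow> 0) (at_right_end \<alpha>)"
    using tendsto_minus[OF gap_lim[OF assms(2), of C]] by simp
  show ?thesis using nonpos_near_right_end[OF \<alpha> deriv lim decr] by simp
qed

section \<open>Power bounds for \<open>w\<close>\<close>

lemma h_bounded:
  obtains H where "H > 0" "\<forall>\<^sub>F t in at_right_end \<alpha>. \<bar>h t\<bar> \<le> H"
proof
  show "\<forall>\<^sub>F t in at_right_end \<alpha>. \<bar>h t\<bar> \<le> \<bar>h0\<bar> + 1"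
    using order_tendstoD(2)[OF tendsto_rabs[OF h_lim], of "\<bar>h0\<bar> + 1"]
    by (auto elim: eventually_mono)
qed simp

lemma k'_pos: "k' > 0"
proof -
  have "\<forall>\<^sub>F t in at_right_end \<alpha>. k' > 0"
    using R_ge R_le x_pos
  proof eventually_elim
    case (elim t)
    then have "0 < k * x t powr \<sigma>" using k_pos by simp
    then have "0 < k' * x t powr \<sigma>" using elim by linarith
    then show ?case by (simp add: zero_less_mult_iff)
  qed
  then show ?thesis using at_right_end_neq_bot[OF \<alpha>] by simp
qed

lemma l'_pos: "l' > 0"
proof -
  have "\<forall>\<^sub>F t in at_right_end \<alpha>. l' > 0"
    using d_ge d_le x_pos
  proof eventually_elim
    case (elim t)
    then have "0 < l * x t powr \<delta>" using l_pos by simp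
    then have "0 < l' * x t powr \<delta>" using elim by linarith
    then show ?case by (simp add: zero_less_mult_iff)
  qed
  then show ?thesis using at_right_end_neq_bot[OF \<alpha>] by simp
qed

text \<open>The exponent solves \<open>\<tau> - a * m = m - 1\<close>: source and slope of the
  barrier have the same order, and \<open>m \<le> 1\<close> lets \<open>x powr (m - 1)\<close>
  absorb the bounded drift. Taking \<open>\<tau> = \<sigma>\<close> gives the sharp order for
  \<open>\<sigma> \<le> a\<close>; taking \<open>\<tau> = a\<close> gives a linear bound for
  \<open>\<sigma> \<ge> a\<close>.\<close>

lemma w_upper_balanced:
  assumes \<tau>: "-1 < \<tau>" "\<tau> \<le> \<sigma>" "\<tau> \<le> a"
  obtains C where "C > 0" "\<forall>\<^sub>F t in at_right_end \<alpha>. w t \<le> C * x t powr ((\<tau> + 1) / (a + 1))"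
proof -
  define m where "m = (\<tau> + 1) / (a + 1)"
  have m: "m > 0" "m \<le> 1" "\<tau> - a * m = m - 1"
    using \<tau> a_pos by (auto simp: m_def field_simps)
  obtain H where H: "H > 0" "\<forall>\<^sub>F t in at_right_end \<alpha>. \<bar>h t\<bar> \<le> H" by (rule h_bounded)
  \<comment> \<open>\<open>C \<ge> 1\<close> bounds the factor \<open>C powr (-a)\<close> by 1, so a
    slope \<open>C * m\<close> of at least \<open>H + k'\<close> suffices.\<close>
  define C where "C = max 1 ((H + k') / m)"
  have C: "C \<ge> 1" "H + k' \<le> C * m"
    using m by (auto simp: C_def pos_divide_le_eq[symmetric])
  have "C powr (-a) \<le> 1" using powr_mono[of "-a" 0 C] C a_pos by auto
  have "\<forall>\<^sub>F t in at_right_end \<alpha>.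
      h t + k' * C powr (-a) * x t powr (\<sigma> - a * m) \<le> C * m * x t powr (m - 1)"
    using H(2) x_pos x_less[OF zero_less_one]
  proof eventually_elim
    case (elim t)
    have "k' * C powr (-a) * x t powr (\<sigma> - a * m) \<le> k' * 1 * x t powr (m - 1)"
      using \<open>C powr (-a) \<le> 1\<close> k'_pos elim \<tau> m by (intro mult_mono powr_mono') auto
    moreover have "H * 1 \<le> H * x t powr (m - 1)"
      using elim H(1) m powr_mono'[of "m - 1" 0 "x t"] by (intro mult_left_mono) auto
    moreover have "(H + k') * x t powr (m - 1) \<le> C * m * x t powr (m - 1)"
      using C by (intro mult_right_mono) auto
    ultimately show ?case using elim by (simp add: algebra_simps)
  qed
  then show thesis using w_le_power[of C m] that[of C] m C by (simp add: m_def)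
qed

text \<open>The same balance with a small \<open>C\<close>: the source then outweighs both the drift
  bound \<open>H\<close> and the slope, whose coefficient is at most \<open>m\<close>.\<close>

lemma w_lower_balanced:
  assumes "\<sigma> \<le> a"
  obtains C where "C > 0" "\<forall>\<^sub>F t in at_right_end \<alpha>. C * x t powr ((\<sigma> + 1) / (a + 1)) \<le> w t"
proof -
  define m where "m = (\<sigma> + 1) / (a + 1)"
  have m: "m > 0" "m \<le> 1" "\<sigma> - a * m = m - 1"
    using assms \<sigma> a_pos by (auto simp: m_def field_simps)
  obtain H where H: "H > 0" "\<forall>\<^sub>F t in at_right_end \<alpha>. \<bar>h t\<bar> \<le> H" by (rule h_bounded)
  obtain C where C: "0 < C" "C \<le> 1" "H + m \<le> k * C powr (-a)"
    using powr_minus_large[OF k_pos a_pos] by blast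
  have "\<forall>\<^sub>F t in at_right_end \<alpha>.
      C * m * x t powr (m - 1) \<le> h t + k * C powr (-a) * x t powr (\<sigma> - a * m)"
    using H(2) x_pos x_less[OF zero_less_one]
  proof eventually_elim
    case (elim t)
    have "C * m * x t powr (m - 1) \<le> 1 * m * x t powr (m - 1)"
      using C m by (intro mult_mono) auto
    moreover have "H * 1 \<le> H * x t powr (m - 1)"
      using elim H(1) m powr_mono'[of "m - 1" 0 "x t"] by (intro mult_left_mono) auto
    moreover have "(H + m) * x t powr (m - 1) \<le> k * C powr (-a) * x t powr (m - 1)"
      using C by (intro mult_right_mono) auto
    moreover have "- H \<le> h t" using elim by linarith
    ultimately show ?case unfolding m(3) distrib_right by linarith
  qed
  then show thesis using w_ge_power[of C m] that[of C] m C by (simp add: m_def)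
qed

text \<open>For \<open>m = \<sigma> / a\<close> the source term on the barrier is constant. A small
  \<open>C\<close> makes it exceed the drift bound plus the slope, which stays below
  \<open>m\<close> as \<open>m > 1\<close> and \<open>x < 1\<close>; the sign of \<open>h\<close>
  does not enter.\<close>

lemma w_lower_source:
  assumes "\<sigma> > a"
  obtains C where "C > 0" "\<forall>\<^sub>F t in at_right_end \<alpha>. C * x t powr (\<sigma> / a) \<le> w t"
proof -
  define m where "m = \<sigma> / a"
  have m: "m > 1" "\<sigma> - a * m = 0"
    using assms a_pos by (auto simp: m_def field_simps)
  obtain H where H: "H > 0" "\<forall>\<^sub>F t in at_right_end \<alpha>. \<bar>h t\<bar> \<le> H" by (rule h_bounded)
  obtain C where C: "0 < C" "C \<le> 1" "H + m \<le> k * C powr (-a)"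
    using powr_minus_large[OF k_pos a_pos] by blast
  have "\<forall>\<^sub>F t in at_right_end \<alpha>.
      C * m * x t powr (m - 1) \<le> h t + k * C powr (-a) * x t powr (\<sigma> - a * m)"
    using H(2) x_pos x_less[OF zero_less_one]
  proof eventually_elim
    case (elim t)
    have "C * m * x t powr (m - 1) \<le> 1 * m * 1"
      using C m elim powr_mono'[of 0 "m - 1" "x t"] by (intro mult_mono) auto
    moreover have "x t powr (\<sigma> - a * m) = 1" using elim m by simp
    moreover have "- H \<le> h t" using elim by linarith
    ultimately show ?case using C(3) by simp
  qed
  then show thesis using w_ge_power[of C m] that[of C] m C by (simp add: m_def)
qed

text \<open>On the same barrier with a large \<open>C\<close>, the constant source is at most
  \<open>- h0 / 2\<close> while \<open>h < h0 / 2\<close>. The left side is negative and the slope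
  nonnegative.\<close>

lemma w_upper_source:
  assumes "\<sigma> > a" "h0 < 0"
  obtains C where "C > 0" "\<forall>\<^sub>F t in at_right_end \<alpha>. w t \<le> C * x t powr (\<sigma> / a)"
proof -
  define m where "m = \<sigma> / a"
  have m: "m > 1" "\<sigma> - a * m = 0"
    using assms a_pos by (auto simp: m_def field_simps)
  obtain C where C: "1 \<le> C" "k' * C powr (-a) \<le> - h0 / 2"
    using powr_minus_small[of "- h0 / 2" a k'] a_pos assms by auto
  have "\<forall>\<^sub>F t in at_right_end \<alpha>. h t < h0 / 2"
    using order_tendstoD(2)[OF h_lim, of "h0 / 2"] assms by simp
  then have "\<forall>\<^sub>F t in at_right_end \<alpha>.
      h t + k' * C powr (-a) * x t powr (\<sigma> - a * m) \<le> C * m * x t powr (m - 1)"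
    using x_pos
  proof eventually_elim
    case (elim t)
    have "0 \<le> C * m * x t powr (m - 1)" using C m by simp
    moreover have "x t powr (\<sigma> - a * m) = 1" using elim m by simp
    ultimately show ?case using C(2) elim by simp
  qed
  then show thesis using w_le_power[of C m] that[of C] m C by (simp add: m_def)
qed

text \<open>The drift alone exceeds the slope \<open>h0 / 2\<close>, and the source only helps. The
  exponent 1 is written out to match the power form of the other bounds.\<close>

lemma w_lower_drift:
  assumes "h0 > 0"
  shows "\<forall>\<^sub>F t in at_right_end \<alpha>. h0 / 2 * x t powr 1 \<le> w t"
proof (rule w_ge_power)
  have "\<forall>\<^sub>F t in at_right_end \<alpha>. h0 / 2 < h t"
    using order_tendstoD(1)[OF h_lim, of "h0 / 2"] assms by simp
  then show "\<forall>\<^sub>F t in at_right_end \<alpha>.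
      h0 / 2 * 1 * x t powr (1 - 1) \<le> h t + k * (h0 / 2) powr (-a) * x t powr (\<sigma> - a * 1)"
    using x_pos
  proof eventually_elim
    case (elim t)
    have "0 \<le> k * (h0 / 2) powr (-a) * x t powr (\<sigma> - a * 1)" using k_pos by simp
    moreover have "x t powr (1 - 1) = 1" using elim by simp
    ultimately show ?case using elim by simp
  qed
qed (use assms in auto)

text \<open>This says \<open>w = o(x)\<close>: on a line of slope \<open>e\<close> the source
  vanishes in the limit since \<open>\<sigma> > a\<close>, and the drift tends to
  \<open>h0 \<le> 0\<close>, so their sum falls below \<open>e\<close>.\<close>

lemma w_small_linear:
  assumes "\<sigma> > a" "h0 \<le> 0" "e > 0"
  shows "\<forall>\<^sub>F t in at_right_end \<alpha>. w t \<le> e * x t powr 1"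
proof (rule w_le_power)
  have "((\<lambda>t. h t + k' * e powr (-a) * x t powr (\<sigma> - a)) \<longlongrightarrow> h0 + k' * e powr (-a) * 0)
      (at_right_end \<alpha>)"
    using assms by (intro tendsto_add tendsto_mult tendsto_const h_lim x_powr_lim) simp
  from order_tendstoD(2)[OF this, of e]
  have "\<forall>\<^sub>F t in at_right_end \<alpha>. h t + k' * e powr (-a) * x t powr (\<sigma> - a) < e"
    using assms by simp
  then show "\<forall>\<^sub>F t in at_right_end \<alpha>.
      h t + k' * e powr (-a) * x t powr (\<sigma> - a * 1) \<le> e * 1 * x t powr (1 - 1)"
    using x_pos by eventually_elim simp
qed (use assms in auto)

section \<open>From \<open>w\<close> to the speed \<open>v\<close>\<close>

lemma v_le_power:
  assumes "C > 0" "\<forall>\<^sub>F t in at_right_end \<alpha>. w t \<le> C * x t powr m"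
  shows "\<forall>\<^sub>F t in at_right_end \<alpha>. v t \<le> (C / l) powr a * x t powr (a * (m - \<delta>))"
  using assms(2) v_eq w_pos x_pos d_ge
proof eventually_elim
  case (elim t)
  have "0 < l * x t powr \<delta>" using l_pos elim by simp
  then have "w t / d t \<le> C * x t powr m / (l * x t powr \<delta>)"
    using elim assms(1) by (intro frac_le) auto
  also have "\<dots> = C / l * x t powr (m - \<delta>)" by (simp add: powr_diff)
  finally have "(w t / d t) powr a \<le> (C / l * x t powr (m - \<delta>)) powr a"
    using elim a_pos \<open>0 < l * x t powr \<delta>\<close> by (intro powr_mono2) auto
  then show ?case
    using elim unfolding powr_mult[of "C / l"] powr_powr by (simp add: mult.commute[of a])
qed

lemma v_ge_power:
  assumes "C > 0" "\<forall>\<^sub>F t in at_right_end \<alpha>. C * x t powr m \<le> w t"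
  shows "\<forall>\<^sub>F t in at_right_end \<alpha>. (C / l') powr a * x t powr (a * (m - \<delta>)) \<le> v t"
  using assms(2) v_eq w_pos x_pos d_ge d_le
proof eventually_elim
  case (elim t)
  have "0 < l * x t powr \<delta>" using l_pos elim by simp
  then have "C * x t powr m / (l' * x t powr \<delta>) \<le> w t / d t"
    using elim assms(1) by (intro frac_le) auto
  moreover have "C * x t powr m / (l' * x t powr \<delta>) = C / l' * x t powr (m - \<delta>)"
    by (simp add: powr_diff)
  ultimately have "(C / l' * x t powr (m - \<delta>)) powr a \<le> (w t / d t) powr a"
    using elim a_pos assms(1) l'_pos by (intro powr_mono2) auto
  then show ?case
    using elim unfolding powr_mult[of "C / l'"] powr_powr by (simp add: mult.commute[of a])
qed

section \<open>Finite or infinite end point\<close>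

text \<open>The function \<open>x powr (1 - s)\<close> grows at least at the rate
  \<open>C * (1 - s)\<close>, so on a half-line reaching -\<infinity> it would become
  negative.\<close>

lemma finite_end:
  assumes "C > 0" "s < 1" and ge: "\<forall>\<^sub>F t in at_right_end \<alpha>. C * x t powr s \<le> v t"
  shows "-\<infinity> < \<alpha>"
proof (rule ccontr)
  assume "\<not> -\<infinity> < \<alpha>"
  then have \<alpha>_eq: "\<alpha> = -\<infinity>" by auto
  define G where "G = (\<lambda>t. x t powr (1 - s))"
  define e where "e = C * (1 - s)"
  have e: "e > 0" using assms by (simp add: e_def)
  have "\<forall>\<^sub>F t in at_bot. \<exists>y. (G has_real_derivative y) (at t) \<and> y \<ge> e"
    using deriv_x x_pos ge unfolding \<alpha>_eq at_right_end_simps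
  proof eventually_elim
    case (elim t)
    have "(G has_real_derivative (1 - s) * x t powr (1 - s - 1) * v t) (at t)"
      unfolding G_def by (rule derivative_eq_intros elim refl)+
    moreover have "C * x t powr s * ((1 - s) * x t powr (- s)) \<le> v t * ((1 - s) * x t powr (- s))"
      using elim assms by (intro mult_right_mono) auto
    moreover have "x t powr s * x t powr (- s) = 1" using elim by (simp add: powr_add[symmetric])
    ultimately show ?case
      by (intro exI[of _ "(1 - s) * x t powr (1 - s - 1) * v t"]) (simp add: e_def algebra_simps)
  qed
  then obtain b where D: "\<And>t. t \<le> b \<Longrightarrow> \<exists>y. (G has_real_derivative y) (at t) \<and> y \<ge> e"
    unfolding eventually_at_bot_linorder by blast
  \<comment> \<open>Chosen so that \<open>e * (b - t) = G b + 1\<close>, which forces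
    \<open>G t \<le> -1\<close>.\<close>
  define t where "t = b - (G b + 1) / e"
  have "G b \<ge> 0" by (simp add: G_def)
  then have "t < b" using e by (simp add: t_def)
  have "G t - e * t \<le> G b - e * b"
  proof (rule DERIV_nonneg_imp_nondecreasing[where f = "\<lambda>t. G t - e * t"])
    fix s assume "t \<le> s" "s \<le> b"
    then obtain y where y: "(G has_real_derivative y) (at s)" "y \<ge> e" using D by blast
    have "((\<lambda>t. G t - e * t) has_real_derivative (y - e)) (at s)"
      by (rule derivative_eq_intros y refl)+ simp
    then show "\<exists>y. ((\<lambda>t. G t - e * t) has_real_derivative y) (at s) \<and> 0 \<le> y"
      using y by (intro exI[of _ "y - e"]) auto
  qed (use \<open>t < b\<close> in simp)
  moreover have "G t \<ge> 0" by (simp add: G_def)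
  moreover have "e * (b - t) = G b + 1" using e by (simp add: t_def)
  ultimately show False by (simp add: algebra_simps)
qed

text \<open>The logarithmic derivative of \<open>x\<close> is at most \<open>C\<close>. Over a
  bounded interval \<open>ln x\<close> then falls only by a finite amount, so \<open>x\<close>
  cannot reach 0.\<close>

lemma infinite_end:
  assumes "C > 0" and le: "\<forall>\<^sub>F t in at_right_end \<alpha>. v t \<le> C * x t"
  shows "\<alpha> = -\<infinity>"
proof (rule ccontr)
  assume "\<alpha> \<noteq> -\<infinity>"
  then obtain A where A: "\<alpha> = ereal A" using \<alpha> by (cases \<alpha>) auto
  have "\<forall>\<^sub>F t in at_right A. 0 < x t \<and> (\<exists>y. ((\<lambda>t. ln (x t)) has_real_derivative y) (at t) \<and> y \<le> C)"
    using deriv_x x_pos le unfolding A at_right_end_simps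
  proof eventually_elim
    case (elim t)
    have "((\<lambda>t. ln (x t)) has_real_derivative v t / x t) (at t)"
      by (rule derivative_eq_intros elim refl)+ simp
    moreover have "v t / x t \<le> C" using elim by (simp add: divide_le_eq)
    ultimately show ?case using elim by blast
  qed
  then obtain b where b: "A < b" and D: "\<And>t. A < t \<Longrightarrow> t < b \<Longrightarrow>
      0 < x t \<and> (\<exists>y. ((\<lambda>t. ln (x t)) has_real_derivative y) (at t) \<and> y \<le> C)"
    unfolding eventually_at_right_field by blast
  define t1 where "t1 = (A + b) / 2"
  have t1: "A < t1" "t1 < b" using b by (auto simp: t1_def)
  \<comment> \<open>Lower bound for \<open>x\<close> left of \<open>t1\<close>: going back from
    \<open>t1\<close> to \<open>A\<close>, \<open>ln x\<close> loses at most
    \<open>C * (t1 - A)\<close>.\<close>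
  define e where "e = exp (ln (x t1) - C * (t1 - A))"
  have "e \<le> x t" if t: "A < t" "t < t1" for t
  proof -
    have "ln (x t1) - C * t1 \<le> ln (x t) - C * t"
    proof (rule DERIV_nonpos_imp_nonincreasing[where f = "\<lambda>t. ln (x t) - C * t"])
      fix s assume "t \<le> s" "s \<le> t1"
      then obtain y where y: "((\<lambda>t. ln (x t)) has_real_derivative y) (at s)" "y \<le> C"
        using D[of s] t t1 by auto
      have "((\<lambda>t. ln (x t) - C * t) has_real_derivative (y - C)) (at s)"
        by (rule derivative_eq_intros y refl)+ simp
      then show "\<exists>y. ((\<lambda>t. ln (x t) - C * t) has_real_derivative y) (at s) \<and> y \<le> 0"
        using y by (intro exI[of _ "y - C"]) auto
    qed (use t in simp)
    moreover have "C * A \<le> C * t" using t assms by simp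
    ultimately have "ln (x t1) - C * (t1 - A) \<le> ln (x t)" by (simp add: algebra_simps)
    then have "e \<le> exp (ln (x t))" unfolding e_def by simp
    then show ?thesis using D[of t] t t1 by simp
  qed
  then have "\<forall>\<^sub>F t in at_right A. e \<le> x t"
    unfolding eventually_at_right_field using t1 by blast
  moreover have "\<forall>\<^sub>F t in at_right A. x t < e"
    using x_less[of e] unfolding A at_right_end_simps by (simp add: e_def)
  ultimately have "\<forall>\<^sub>F t in at_right A. False" by eventually_elim simp
  then show False by simp
qed

lemma finite_end_of_lower:
  assumes "C > 0" "\<forall>\<^sub>F t in at_right_end \<alpha>. C * x t powr m \<le> w t" "a * (m - \<delta>) < 1"
  shows "-\<infinity> < \<alpha>"
  using finite_end[OF _ assms(3) v_ge_power[OF assms(1,2)]] assms(1) l'_pos by simp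

lemma infinite_end_of_upper:
  assumes "C > 0" "\<forall>\<^sub>F t in at_right_end \<alpha>. w t \<le> C * x t powr m" "a * (m - \<delta>) \<ge> 1"
  shows "\<alpha> = -\<infinity>"
proof (rule infinite_end)
  show "0 < (C / l) powr a" using assms(1) l_pos by simp
  show "\<forall>\<^sub>F t in at_right_end \<alpha>. v t \<le> (C / l) powr a * x t"
    using v_le_power[OF assms(1,2)] x_pos x_less[OF zero_less_one]
  proof eventually_elim
    case (elim t)
    have "x t powr (a * (m - \<delta>)) \<le> x t powr 1"
      using elim assms(3) by (intro powr_mono') auto
    then have "(C / l) powr a * x t powr (a * (m - \<delta>)) \<le> (C / l) powr a * x t powr 1"
      by (intro mult_left_mono) auto
    then show ?case using elim by simp
  qed
qed

text \<open>The exponent 1 still gives an infinite end, so the two one-sided criteria are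
  complementary once \<open>w\<close> has bounds of the same order \<open>m\<close>.\<close>

lemma finite_end_iff:
  assumes "c > 0" "\<forall>\<^sub>F t in at_right_end \<alpha>. c * x t powr m \<le> w t"
    and "C > 0" "\<forall>\<^sub>F t in at_right_end \<alpha>. w t \<le> C * x t powr m"
  shows "-\<infinity> < \<alpha> \<longleftrightarrow> a * (m - \<delta>) < 1"
  using finite_end_of_lower[OF assms(1,2)] infinite_end_of_upper[OF assms(3,4)] by force

section \<open>Limits of the speed\<close>

lemma v_nonneg: "\<forall>\<^sub>F t in at_right_end \<alpha>. 0 \<le> v t"
  using v_eq by eventually_elim simp

lemma v_lim_0:
  assumes "C > 0" "\<forall>\<^sub>F t in at_right_end \<alpha>. w t \<le> C * x t powr m" "\<delta> < m"
  shows "(v \<longlongrightarrow> 0) (at_right_end \<alpha>)"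
proof (rule tendsto_sandwich[OF v_nonneg v_le_power[OF assms(1,2)] tendsto_const])
  show "((\<lambda>t. (C / l) powr a * x t powr (a * (m - \<delta>))) \<longlongrightarrow> 0) (at_right_end \<alpha>)"
    using assms a_pos by (intro tendsto_mult_right_zero x_powr_lim) simp
qed

lemma v_lim_at_top:
  assumes "C > 0" "\<forall>\<^sub>F t in at_right_end \<alpha>. C * x t powr m \<le> w t" "m < \<delta>"
  shows "filterlim v at_top (at_right_end \<alpha>)"
proof (rule filterlim_at_top_mono[OF _ v_ge_power[OF assms(1,2)]])
  have "((\<lambda>t. x t powr (a * (\<delta> - m))) \<longlongrightarrow> 0) (at_right_end \<alpha>)"
    using assms a_pos by (intro x_powr_lim) simp
  then have "filterlim (\<lambda>t. x t powr (a * (\<delta> - m))) (at_right 0) (at_right_end \<alpha>)"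
    unfolding filterlim_at using x_pos by (auto elim: eventually_mono)
  then have "filterlim (\<lambda>t. inverse (x t powr (a * (\<delta> - m)))) at_top (at_right_end \<alpha>)"
    by (rule filterlim_compose[OF filterlim_inverse_at_top_right])
  then have "filterlim (\<lambda>t. (C / l') powr a * inverse (x t powr (a * (\<delta> - m)))) at_top (at_right_end \<alpha>)"
    using assms l'_pos by (intro filterlim_tendsto_pos_mult_at_top[OF tendsto_const]) auto
  then show "filterlim (\<lambda>t. (C / l') powr a * x t powr (a * (m - \<delta>))) at_top (at_right_end \<alpha>)"
    by (simp add: powr_minus[symmetric] algebra_simps)
qed

text \<open>For \<open>\<delta> = 1\<close> a linear bound on \<open>w\<close> only bounds
  \<open>v\<close>; the arbitrarily small slopes of \<open>w_small_linear\<close> are what push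
  \<open>v\<close> to 0.\<close>

lemma v_lim_0_critical:
  assumes "\<delta> = 1" "\<sigma> > a" "h0 \<le> 0"
  shows "(v \<longlongrightarrow> 0) (at_right_end \<alpha>)"
proof (rule order_tendstoI)
  fix e :: real assume "e < 0"
  then show "\<forall>\<^sub>F t in at_right_end \<alpha>. e < v t" using v_nonneg by (auto elim: eventually_mono)
next
  fix e :: real assume e: "0 < e"
  \<comment> \<open>Solves \<open>(C / l) powr a = e / 2\<close>.\<close>
  define C where "C = l * (e / 2) powr (1 / a)"
  have C: "C > 0" using e l_pos by (simp add: C_def)
  have "(C / l) powr a = e / 2" using e l_pos a_pos by (simp add: C_def powr_powr)
  show "\<forall>\<^sub>F t in at_right_end \<alpha>. v t < e"
    using v_le_power[OF C w_small_linear[OF assms(2,3) C]] x_pos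
  proof eventually_elim
    case (elim t)
    have "x t powr (a * (1 - \<delta>)) = 1" using elim assms(1) by simp
    then show ?case using elim e \<open>(C / l) powr a = e / 2\<close> by simp
  qed
qed

text \<open>The linear lower bound on \<open>w\<close> and \<open>d\<close> of order
  \<open>x\<close> keep \<open>v\<close> above a positive constant.\<close>

lemma not_v_lim_0_critical:
  assumes "\<delta> = 1" "h0 > 0"
  shows "\<not> (v \<longlongrightarrow> 0) (at_right_end \<alpha>)"
proof
  assume lim: "(v \<longlongrightarrow> 0) (at_right_end \<alpha>)"
  define e where "e = (h0 / 2 / l') powr a"
  have "e > 0" using assms l'_pos by (simp add: e_def)
  have "\<forall>\<^sub>F t in at_right_end \<alpha>. e * x t powr (a * (1 - \<delta>)) \<le> v t"
    unfolding e_def using assms by (intro v_ge_power w_lower_drift) auto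
  with order_tendstoD(2)[OF lim \<open>e > 0\<close>] x_pos have "\<forall>\<^sub>F t in at_right_end \<alpha>. False"
    by eventually_elim (use assms in simp)
  then show False using at_right_end_neq_bot[OF \<alpha>] by simp
qed

section \<open>Criteria in each regime\<close>

lemma w_upper_linear:
  assumes "\<sigma> \<ge> a"
  obtains C where "C > 0" "\<forall>\<^sub>F t in at_right_end \<alpha>. w t \<le> C * x t powr 1"
  using w_upper_balanced[of a] assms a_pos by auto

lemma finite_end_iff_balanced:
  assumes "\<sigma> \<le> a"
  shows "-\<infinity> < \<alpha> \<longleftrightarrow> a * ((\<sigma> + 1) / (a + 1) - \<delta>) < 1"
proof -
  obtain c where c: "c > 0" "\<forall>\<^sub>F t in at_right_end \<alpha>. c * x t powr ((\<sigma> + 1) / (a + 1)) \<le> w t"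
    using w_lower_balanced[OF assms] .
  obtain C where C: "C > 0" "\<forall>\<^sub>F t in at_right_end \<alpha>. w t \<le> C * x t powr ((\<sigma> + 1) / (a + 1))"
    using w_upper_balanced[OF \<sigma> order_refl assms] .
  show ?thesis by (rule finite_end_iff[OF c C])
qed

lemma finite_end_iff_drift:
  assumes "\<sigma> > a" "h0 > 0"
  shows "-\<infinity> < \<alpha> \<longleftrightarrow> a * (1 - \<delta>) < 1"
proof -
  obtain C where C: "C > 0" "\<forall>\<^sub>F t in at_right_end \<alpha>. w t \<le> C * x t powr 1"
    using w_upper_linear assms by auto
  show ?thesis by (rule finite_end_iff[OF _ w_lower_drift C]) (use assms in auto)
qed

lemma finite_end_iff_source:
  assumes "\<sigma> > a" "h0 < 0"
  shows "-\<infinity> < \<alpha> \<longleftrightarrow> \<sigma> - a * \<delta> < 1"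
proof -
  obtain c where c: "c > 0" "\<forall>\<^sub>F t in at_right_end \<alpha>. c * x t powr (\<sigma> / a) \<le> w t"
    using w_lower_source[OF assms(1)] .
  obtain C where C: "C > 0" "\<forall>\<^sub>F t in at_right_end \<alpha>. w t \<le> C * x t powr (\<sigma> / a)"
    using w_upper_source[OF assms] .
  show ?thesis using finite_end_iff[OF c C] a_pos by (simp add: right_diff_distrib)
qed

text \<open>Only the lower bound is used, which holds for every \<open>h0\<close>; this reaches the
  case \<open>h0 = 0\<close>, where only one implication is claimed.\<close>

lemma finite_end_source:
  assumes "\<sigma> > a" "\<sigma> - a * \<delta> < 1"
  shows "-\<infinity> < \<alpha>"
proof -
  obtain c where c: "c > 0" "\<forall>\<^sub>F t in at_right_end \<alpha>. c * x t powr (\<sigma> / a) \<le> w t"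
    using w_lower_source[OF assms(1)] .
  show ?thesis using finite_end_of_lower[OF c] assms a_pos by (simp add: right_diff_distrib)
qed

text \<open>The order of the upper bound exceeds \<delta> in both cases: for
  \<open>\<sigma> \<le> a\<close> by adding \<open>a * \<delta> < \<sigma>\<close> and
  \<open>\<delta> < 1\<close>, otherwise because it is 1.\<close>

lemma v_lim_0_subcritical:
  assumes "\<delta> < 1" "\<sigma> > a * \<delta>"
  shows "(v \<longlongrightarrow> 0) (at_right_end \<alpha>)"
proof (cases "\<sigma> \<le> a")
  case True
  obtain C where C: "C > 0" "\<forall>\<^sub>F t in at_right_end \<alpha>. w t \<le> C * x t powr ((\<sigma> + 1) / (a + 1))"
    using w_upper_balanced[OF \<sigma> order_refl True] .
  have "\<delta> * (a + 1) < \<sigma> + 1" using assms by (simp add: algebra_simps)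
  then have "\<delta> < (\<sigma> + 1) / (a + 1)" using a_pos by (simp add: pos_less_divide_eq)
  then show ?thesis by (rule v_lim_0[OF C])
next
  case False
  then obtain C where C: "C > 0" "\<forall>\<^sub>F t in at_right_end \<alpha>. w t \<le> C * x t powr 1"
    using w_upper_linear by auto
  show ?thesis by (rule v_lim_0[OF C assms(1)])
qed

lemma v_lim_0_source:
  assumes "\<sigma> > a" "h0 < 0" "\<sigma> > a * \<delta>"
  shows "(v \<longlongrightarrow> 0) (at_right_end \<alpha>)"
proof -
  obtain C where C: "C > 0" "\<forall>\<^sub>F t in at_right_end \<alpha>. w t \<le> C * x t powr (\<sigma> / a)"
    using w_upper_source[OF assms(1,2)] .
  show ?thesis using v_lim_0[OF C] assms(3) a_pos by (simp add: pos_less_divide_eq mult.commute)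
qed

lemma v_lim_at_top_drift:
  assumes "\<delta> > 1" "h0 > 0"
  shows "filterlim v at_top (at_right_end \<alpha>)"
  using v_lim_at_top[OF _ w_lower_drift assms(1)] assms(2) by simp

end

section \<open>Two-sided bounds from asymptotic equivalence\<close>

lemma asymp_equiv_imp_between:
  fixes f g :: "'a \<Rightarrow> real"
  assumes "f \<sim>[F] g" "\<forall>\<^sub>F x in F. g x > 0"
  shows "\<forall>\<^sub>F x in F. g x / 2 \<le> f x" "\<forall>\<^sub>F x in F. f x \<le> 2 * g x"
proof -
  have lim: "((\<lambda>x. f x / g x) \<longlongrightarrow> 1) F"
    using assms by (intro asymp_equivD_strong) (auto elim: eventually_mono)
  have "\<forall>\<^sub>F x in F. 1 / 2 < f x / g x" using order_tendstoD(1)[OF lim, of "1/2"] by simp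
  with assms(2) show "\<forall>\<^sub>F x in F. g x / 2 \<le> f x"
    by eventually_elim (simp add: field_simps)
  have "\<forall>\<^sub>F x in F. f x / g x < 2" using order_tendstoD(2)[OF lim, of 2] by simp
  with assms(2) show "\<forall>\<^sub>F x in F. f x \<le> 2 * g x"
    by eventually_elim (simp add: field_simps)
qed

section \<open>Strict monotonicity of the wave\<close>

text \<open>At the first zero \<open>s\<close> after \<open>t0\<close> the negative derivative makes
  \<open>G\<close> positive just before \<open>s\<close>, so there is an even earlier zero.\<close>

lemma negative_if_no_upcrossing:
  fixes G G' :: "real \<Rightarrow> real"
  assumes D: "\<And>t. t0 \<le> t \<Longrightarrow> t \<le> t1 \<Longrightarrow> (G has_real_derivative G' t) (at t)"
    and zero: "\<And>t. t0 \<le> t \<Longrightarrow> t \<le> t1 \<Longrightarrow> G t = 0 \<Longrightarrow> G' t < 0"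
    and "G t0 < 0" "t0 \<le> t1"
  shows "G t1 < 0"
proof (rule ccontr)
  assume "\<not> G t1 < 0"
  have cont: "continuous_on {t0..t1} G"
  proof (rule DERIV_continuous_on)
    fix t assume "t \<in> {t0..t1}"
    then show "(G has_real_derivative G' t) (at t within {t0..t1})"
      using D[of t] has_field_derivative_at_within by fastforce
  qed
  define S where "S = {t0..t1} \<inter> G -` {0}"
  have "compact S"
    unfolding S_def using continuous_on_closed_vimage[of "{t0..t1}" G] cont
    by (metis Int_commute bounded_Int bounded_closed_interval closed_atLeastAtMost closed_singleton
        compact_eq_bounded_closed)
  moreover have "S \<noteq> {}"
    using IVT'[of G t0 0 t1] cont assms(3,4) \<open>\<not> G t1 < 0\<close> by (force simp: S_def)
  ultimately obtain s where s: "s \<in> S" "\<And>t. t \<in> S \<Longrightarrow> s \<le> t"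
    using compact_attains_inf[of S] by blast
  have st: "t0 < s" "s \<le> t1" "G s = 0"
    using s(1) assms(3) by (auto simp: S_def order.order_iff_strict)
  obtain e where e: "e > 0" "\<And>h. 0 < h \<Longrightarrow> h < e \<Longrightarrow> G s < G (s - h)"
    using DERIV_neg_dec_left[OF D zero, of s] st by auto
  define h where "h = min (e / 2) (s - t0)"
  have h: "0 < h" "h < e" "h \<le> s - t0" using e st by (auto simp: h_def)
  then have "G (s - h) > 0" using e(2)[of h] st by simp
  moreover have "continuous_on {t0..s - h} G" using cont st h by (auto intro: continuous_on_subset)
  ultimately obtain z where "t0 \<le> z" "z \<le> s - h" "G z = 0"
    using IVT'[of G t0 0 "s - h"] assms(3) h by auto
  then show False using s(2)[of z] st h by (auto simp: S_def)
qed

lemma traveling_wave_derivs: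
  assumes "traveling_wave p f g \<rho> d c \<alpha> \<beta> u" "t \<in> einterval \<alpha> \<beta>"
  shows "(u has_real_derivative deriv u t) (at t)"
    and "(flux p d u has_real_derivative deriv (flux p d u) t) (at t)"
  using assms unfolding traveling_wave_def C1_differentiable_on_def
  by (metis DERIV_imp_deriv has_real_derivative_iff_has_vector_derivative)+

lemma flux_sign:
  assumes "d (u t) > 0"
  shows "flux p d u t > 0 \<longleftrightarrow> deriv u t > 0" "flux p d u t < 0 \<longleftrightarrow> deriv u t < 0"
    "flux p d u t = 0 \<longleftrightarrow> deriv u t = 0"
proof -
  have "deriv u t \<noteq> 0 \<Longrightarrow> d (u t) * \<bar>deriv u t\<bar> powr (p - 2) > 0" using assms by simp
  then show "flux p d u t > 0 \<longleftrightarrow> deriv u t > 0" "flux p d u t < 0 \<longleftrightarrow> deriv u t < 0"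
    "flux p d u t = 0 \<longleftrightarrow> deriv u t = 0"
    unfolding flux_def by (cases "deriv u t = 0"; force simp: zero_less_mult_iff mult_less_0_iff)+
qed

lemma traveling_wave_decreasing:
  assumes st: "standing_assumptions p f g \<rho> d"
    and tw: "traveling_wave p f g \<rho> d c \<alpha> \<beta> u"
    and t1: "t1 \<in> einterval \<alpha> \<beta>"
  shows "deriv u t1 < 0"
proof (rule ccontr)
  assume "\<not> deriv u t1 < 0"
  let ?G = "flux p d u"
  have \<alpha>\<beta>: "\<alpha> < \<beta>" and u01: "\<And>t. t \<in> einterval \<alpha> \<beta> \<Longrightarrow> 0 < u t \<and> u t < 1"
    and eq: "\<And>t. t \<in> einterval \<alpha> \<beta> \<Longrightarrow>
        deriv ?G t + (c * g (u t) - f (u t)) * deriv u t + \<rho> (u t) = 0"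
    and u_lim: "(u \<longlongrightarrow> 1) (at_right_end \<alpha>)"
    using tw unfolding traveling_wave_def filterlim_at_right_end_iff by auto
  have "\<alpha> < \<infinity>" using \<alpha>\<beta> by auto
  have pos: "d (u t) > 0" "\<rho> (u t) > 0" if "t \<in> einterval \<alpha> \<beta>" for t
    using st u01[OF that] unfolding standing_assumptions_def by auto
  \<comment> \<open>A zero of the flux is a zero of \<open>deriv u\<close>, so the equation leaves
    only \<open>- \<rho> (u t)\<close>.\<close>
  have zero: "deriv ?G t < 0" if "t \<in> einterval \<alpha> \<beta>" "?G t = 0" for t
    using eq[OF that(1)] pos[OF that(1)] that flux_sign(3)[of d u t p] by simp
  have between: "t \<in> einterval \<alpha> \<beta>" if "t0 \<in> einterval \<alpha> \<beta>" "t0 \<le> t" "t \<le> t1" for t t0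
    using that t1 unfolding einterval_iff
    by (meson ereal_less_eq(3) le_less_trans less_le_trans)
  \<comment> \<open>Otherwise the flux is negative at some \<open>s\<close> in
    \<open>[t0, t1]\<close>, at once or just after a zero at \<open>t0\<close>, and stays negative
    up to \<open>t1\<close>, against the assumption there.\<close>
  have Gpos: "?G t0 > 0" if t0: "t0 \<in> einterval \<alpha> \<beta>" "t0 < t1" for t0
  proof (rule ccontr)
    assume "\<not> ?G t0 > 0"
    have "\<exists>s. t0 \<le> s \<and> s \<le> t1 \<and> ?G s < 0"
    proof (cases "?G t0 = 0")
      case True
      from DERIV_neg_dec_right[OF traveling_wave_derivs(2)[OF tw t0(1)] zero[OF t0(1) True]]
      obtain e where e: "e > 0" "\<And>h. 0 < h \<Longrightarrow> h < e \<Longrightarrow> ?G (t0 + h) < ?G t0" by auto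
      define h where "h = min (e / 2) (t1 - t0)"
      have h: "0 < h" "h < e" "h \<le> t1 - t0" using e t0 by (auto simp: h_def)
      show ?thesis using e(2)[OF h(1,2)] True h by (intro exI[of _ "t0 + h"]) auto
    next
      case False
      then show ?thesis using \<open>\<not> ?G t0 > 0\<close> t0 by (intro exI[of _ t0]) auto
    qed
    then obtain s where s: "t0 \<le> s" "s \<le> t1" "?G s < 0" by blast
    have in_int: "t \<in> einterval \<alpha> \<beta>" if "s \<le> t" "t \<le> t1" for t
      using between[OF t0(1)] s that by simp
    have "?G t1 < 0"
      by (rule negative_if_no_upcrossing[of s t1 ?G "deriv ?G"])
        (use traveling_wave_derivs(2)[OF tw in_int] zero[OF in_int] s in auto)
    then show False
      using \<open>\<not> deriv u t1 < 0\<close> flux_sign(2)[of d u t1 p] pos[OF t1] by simp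
  qed
  \<comment> \<open>Left of \<open>t2\<close> the wave increases, so near \<alpha> it stays below
    \<open>u t2 < 1\<close> and cannot tend to 1.\<close>
  obtain t2 where t2: "\<alpha> < ereal t2" "ereal t2 < ereal t1"
    using ereal_dense2[of \<alpha> "ereal t1"] t1 by (auto simp: einterval_iff)
  have "ereal t2 < \<beta>" using less_trans[OF t2(2)] t1 by (simp add: einterval_iff)
  have inc: "u t \<le> u t2" if "\<alpha> < ereal t" "t < t2" for t
  proof (rule DERIV_nonneg_imp_nondecreasing[where f = u])
    fix s assume s: "t \<le> s" "s \<le> t2"
    have "t \<in> einterval \<alpha> \<beta>"
      using that \<open>ereal t2 < \<beta>\<close> by (auto simp: einterval_iff intro: less_trans[of _ "ereal t2"])
    then have si: "s \<in> einterval \<alpha> \<beta>" using between[of t s] s t2 by auto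
    have "deriv u s > 0"
      using Gpos[OF si] s t2 flux_sign(1)[of d u s p] pos[OF si] by simp
    then show "\<exists>y. (u has_real_derivative y) (at s) \<and> 0 \<le> y"
      using traveling_wave_derivs(1)[OF tw si] by (intro exI[of _ "deriv u s"]) simp
  qed (use that in simp)
  have "u t2 < 1" using u01[of t2] t2 \<open>ereal t2 < \<beta>\<close> by (simp add: einterval_iff)
  have "\<forall>\<^sub>F t in at_right_end \<alpha>. u t2 < u t"
    using order_tendstoD(1)[OF u_lim \<open>u t2 < 1\<close>] .
  moreover have "\<forall>\<^sub>F t in at_right_end \<alpha>. u t \<le> u t2"
    unfolding eventually_at_right_end[OF \<open>\<alpha> < \<infinity>\<close>] using inc t2 by blast
  ultimately have "\<forall>\<^sub>F t in at_right_end \<alpha>. False" by eventually_elim simp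
  then show False using at_right_end_neq_bot[OF \<open>\<alpha> < \<infinity>\<close>] by simp
qed

section \<open>The traveling wave as an instance\<close>

text \<open>Here \<open>k\<close> is the leading coefficient and \<open>r + a * \<delta>\<close> the
  order of \<open>\<rho> d^a\<close> in \<open>1 - u\<close>; the factors 1/2 and 2 turn equivalence
  into bounds.\<close>

lemma wave_end_traveling_wave:
  assumes st: "standing_assumptions p f g \<rho> d"
    and d: "d \<sim>[at_left 1] (\<lambda>v. k1 * (1 - v) powr \<delta>)"
    and \<rho>: "\<rho> \<sim>[at_left 1] (\<lambda>v. k2 * (1 - v) powr r)"
    and "k1 > 0" "k2 > 0"
    and cond: "r * (p - 1) + \<delta> + p > 1"
    and tw: "traveling_wave p f g \<rho> d c \<alpha> \<beta> u"
  defines "a \<equiv> 1 / (p - 1)"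
  defines "k \<equiv> k2 * k1 powr a"
  shows "wave_end \<alpha> (\<lambda>t. 1 - u t) (\<lambda>t. - deriv u t) (\<lambda>t. - flux p d u t)
    (\<lambda>t. f (u t) - c * g (u t)) (\<lambda>t. d (u t)) (\<lambda>t. \<rho> (u t) * d (u t) powr a)
    a \<delta> (r + a * \<delta>) (k / 2) (2 * k) (k1 / 2) (2 * k1) (f 1 - c * g 1)"
proof
  let ?F = "at_right_end \<alpha>" and ?G = "flux p d u"
  have \<alpha>\<beta>: "\<alpha> < \<beta>" and u01: "\<And>t. t \<in> einterval \<alpha> \<beta> \<Longrightarrow> 0 < u t \<and> u t < 1"
    and eq: "\<And>t. t \<in> einterval \<alpha> \<beta> \<Longrightarrow>
        deriv ?G t + (c * g (u t) - f (u t)) * deriv u t + \<rho> (u t) = 0"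
    and u_lim: "(u \<longlongrightarrow> 1) ?F" and G_lim: "(?G \<longlongrightarrow> 0) ?F"
    using tw unfolding traveling_wave_def filterlim_at_right_end_iff by auto
  have "p > 1" using st by (simp add: standing_assumptions_def)
  show "\<alpha> < \<infinity>" using \<alpha>\<beta> by auto
  show "a > 0" using \<open>p > 1\<close> by (simp add: a_def)
  show "k / 2 > 0" "k1 / 2 > 0" using assms(4,5) by (auto simp: k_def)
  \<comment> \<open>As \<open>a * (p - 1) = 1\<close>, this is \<open>cond\<close>
    rearranged.\<close>
  have "- 1 * (p - 1) < (r + a * \<delta>) * (p - 1)"
    using cond \<open>p > 1\<close> by (simp add: a_def distrib_right)
  then show "- 1 < r + a * \<delta>" using \<open>p > 1\<close> by (simp only: mult_less_cancel_right_pos)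
  have ev_int: "\<forall>\<^sub>F t in ?F. t \<in> einterval \<alpha> \<beta>"
    by (rule eventually_einterval_at_right_end[OF \<alpha>\<beta>])
  have pos: "d (u t) > 0" "\<rho> (u t) > 0" if "t \<in> einterval \<alpha> \<beta>" for t
    using st u01[OF that] unfolding standing_assumptions_def by auto
  have w_pos: "?G t < 0" if "t \<in> einterval \<alpha> \<beta>" for t
    using traveling_wave_decreasing[OF st tw that] flux_sign(2)[of d u t p] pos[OF that] by simp
  \<comment> \<open>For \<open>y = - deriv u t > 0\<close> the negated flux is
    \<open>d(u) y^(p-1)\<close>, and the power \<open>a\<close> inverts
    \<open>y^(p-1)\<close>.\<close>
  have v_eq: "- deriv u t = (- ?G t / d (u t)) powr a" if "t \<in> einterval \<alpha> \<beta>" for t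
  proof -
    define y where "y = - deriv u t"
    have "y > 0" using traveling_wave_decreasing[OF st tw that] by (simp add: y_def)
    have "- ?G t / d (u t) = y powr (p - 2) * y"
      using pos[OF that] \<open>y > 0\<close> by (simp add: flux_def y_def)
    also have "\<dots> = y powr (p - 1)"
      using \<open>y > 0\<close> powr_mult_base[of y "p - 2"] by (simp add: mult.commute)
    finally show ?thesis using \<open>y > 0\<close> \<open>p > 1\<close> by (simp add: powr_powr a_def y_def[symmetric])
  qed
  show "\<forall>\<^sub>F t in ?F. ((\<lambda>t. 1 - u t) has_real_derivative - deriv u t) (at t)"
    using ev_int
  proof eventually_elim
    case (elim t)
    show ?case
      by (rule derivative_eq_intros traveling_wave_derivs(1)[OF tw elim] refl)+ simp
  qed
  show "\<forall>\<^sub>F t in ?F. ((\<lambda>t. - ?G t) has_real_derivative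
      - deriv u t * (f (u t) - c * g (u t) + \<rho> (u t) * d (u t) powr a / (- ?G t) powr a)) (at t)"
    using ev_int
  proof eventually_elim
    case (elim t)
    have "(- ?G t) powr a > 0" "d (u t) powr a > 0"
      using w_pos[OF elim] pos[OF elim] by auto
    \<comment> \<open>Inserting \<open>v = (w / d) powr a\<close> cancels both powers, so the source
      term of the equation is recovered.\<close>
    then have "- deriv u t * (\<rho> (u t) * d (u t) powr a / (- ?G t) powr a) = \<rho> (u t)"
      unfolding v_eq[OF elim] powr_divide by (simp add: field_simps)
    then have "- deriv ?G t =
        - deriv u t * (f (u t) - c * g (u t) + \<rho> (u t) * d (u t) powr a / (- ?G t) powr a)"
      using eq[OF elim] unfolding distrib_left by (simp add: algebra_simps)
    then show ?case using DERIV_minus[OF traveling_wave_derivs(2)[OF tw elim]] by simp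
  qed
  show "\<forall>\<^sub>F t in ?F. 0 < 1 - u t" using ev_int by eventually_elim (use u01 in auto)
  show "\<forall>\<^sub>F t in ?F. 0 < - ?G t" using ev_int by eventually_elim (use w_pos in auto)
  show "\<forall>\<^sub>F t in ?F. - deriv u t = (- ?G t / d (u t)) powr a"
    using ev_int by eventually_elim (use v_eq in auto)
  show "((\<lambda>t. 1 - u t) \<longlongrightarrow> 0) ?F" using tendsto_diff[OF tendsto_const[of 1] u_lim] by simp
  show "((\<lambda>t. - ?G t) \<longlongrightarrow> 0) ?F" using tendsto_minus[OF G_lim] by simp
  \<comment> \<open>The asymptotics are given only from the left of 1; \<open>u < 1\<close> allows
    composing with them.\<close>
  have u_left: "filterlim u (at_left 1) ?F"
    unfolding filterlim_at using u_lim ev_int by (auto elim!: eventually_mono dest: u01)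
  have "((\<lambda>v. f v - c * g v) \<longlongrightarrow> f 1 - c * g 1) (at 1 within {0..1})"
    using st unfolding standing_assumptions_def continuous_on_def
    by (intro tendsto_intros) auto
  then show "((\<lambda>t. f (u t) - c * g (u t)) \<longlongrightarrow> f 1 - c * g 1) ?F"
  proof (rule filterlim_compose)
    show "filterlim u (at 1 within {0..1}) ?F"
      unfolding filterlim_at using u_lim ev_int by (auto elim!: eventually_mono dest: u01)
  qed
  have d_as: "(\<lambda>t. d (u t)) \<sim>[?F] (\<lambda>t. k1 * (1 - u t) powr \<delta>)"
    by (rule asymp_equiv_compose'[OF d u_left])
  have \<rho>_as: "(\<lambda>t. \<rho> (u t)) \<sim>[?F] (\<lambda>t. k2 * (1 - u t) powr r)"
    by (rule asymp_equiv_compose'[OF \<rho> u_left])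
  have "\<forall>\<^sub>F t in ?F. k1 * (1 - u t) powr \<delta> > 0"
    using ev_int by eventually_elim (use u01 assms(4) in force)
  from asymp_equiv_imp_between[OF d_as this]
  show "\<forall>\<^sub>F t in ?F. k1 / 2 * (1 - u t) powr \<delta> \<le> d (u t)"
    "\<forall>\<^sub>F t in ?F. d (u t) \<le> 2 * k1 * (1 - u t) powr \<delta>"
    by (simp_all add: mult.assoc)
  have "(\<lambda>t. d (u t) powr a) \<sim>[?F] (\<lambda>t. (k1 * (1 - u t) powr \<delta>) powr a)"
  proof (rule asymp_equiv_powr_real[OF d_as])
    show "\<forall>\<^sub>F t in ?F. 0 \<le> d (u t)"
      using ev_int by eventually_elim (use pos in \<open>auto intro: less_imp_le\<close>)
    show "\<forall>\<^sub>F t in ?F. 0 \<le> k1 * (1 - u t) powr \<delta>" using assms(4) by simp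
  qed
  from asymp_equiv_mult[OF \<rho>_as this]
  have R_as: "(\<lambda>t. \<rho> (u t) * d (u t) powr a) \<sim>[?F] (\<lambda>t. k * (1 - u t) powr (r + a * \<delta>))"
    by (simp add: k_def powr_mult powr_powr powr_add mult_ac)
  have "\<forall>\<^sub>F t in ?F. k * (1 - u t) powr (r + a * \<delta>) > 0"
    using ev_int by eventually_elim (use u01 assms(4,5) in \<open>force simp: k_def\<close>)
  from asymp_equiv_imp_between[OF R_as this]
  show "\<forall>\<^sub>F t in ?F. k / 2 * (1 - u t) powr (r + a * \<delta>) \<le> \<rho> (u t) * d (u t) powr a"
    "\<forall>\<^sub>F t in ?F. \<rho> (u t) * d (u t) powr a \<le> 2 * k * (1 - u t) powr (r + a * \<delta>)"
    by (simp_all add: mult.assoc)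
qed

section \<open>Translation to the original parameters\<close>

theorem corollary21:
  fixes p k1 k2 r \<delta> c :: real
    and f g \<rho> d u :: "real \<Rightarrow> real"
    and \<alpha> \<beta> :: ereal
  assumes "standing_assumptions p f g \<rho> d"
    and "d \<sim>[at_left 1] (\<lambda>v. k1 * (1 - v) powr \<delta>)"
    and "\<rho> \<sim>[at_left 1] (\<lambda>v. k2 * (1 - v) powr r)"
    and "k1 > 0" and "k2 > 0" and "r > 0"
    and "r * (p - 1) + \<delta> + p > 1"
    and "traveling_wave p f g \<rho> d c \<alpha> \<beta> u"
  shows
    "(r * (p - 1) + \<delta> = 1 \<longrightarrow> (\<alpha> > -\<infinity> \<longleftrightarrow> p + \<delta> > 2)) \<and>
     (r * (p - 1) + \<delta> > 1 \<and> c * g 1 < f 1 \<longrightarrow> (\<alpha> > -\<infinity> \<longleftrightarrow> p + \<delta> > 2)) \<and>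
     (r * (p - 1) + \<delta> > 1 \<and> c * g 1 > f 1 \<longrightarrow> (\<alpha> > -\<infinity> \<longleftrightarrow> r < 1)) \<and>
     (r * (p - 1) + \<delta> > 1 \<and> c * g 1 = f 1 \<and> r < 1 \<longrightarrow> \<alpha> > -\<infinity>) \<and>
     (r * (p - 1) + \<delta> < 1 \<longrightarrow> (\<alpha> > -\<infinity> \<longleftrightarrow> p + \<delta> > r + 1)) \<and>
     (\<alpha> > -\<infinity> \<longrightarrow>
        (\<delta> < 1 \<longrightarrow> ((deriv u \<circ> real_of_ereal) \<longlongrightarrow> 0) (at_right \<alpha>)) \<and>
        (\<delta> = 1 \<longrightarrow>
           (((deriv u \<circ> real_of_ereal) \<longlongrightarrow> 0) (at_right \<alpha>) \<longleftrightarrow> c * g 1 - f 1 \<ge> 0)) \<and>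
        (\<delta> > 1 \<and> c * g 1 > f 1 \<longrightarrow> ((deriv u \<circ> real_of_ereal) \<longlongrightarrow> 0) (at_right \<alpha>)) \<and>
        (\<delta> > 1 \<and> c * g 1 < f 1 \<longrightarrow> filterlim (deriv u \<circ> real_of_ereal) at_bot (at_right \<alpha>)))"
proof -
  let ?F = "at_right_end \<alpha>"
  define a where "a = 1 / (p - 1)"
  define h0 where "h0 = f 1 - c * g 1"
  define \<sigma> where "\<sigma> = r + a * \<delta>"
  have "p > 1" using assms(1) by (simp add: standing_assumptions_def)
  then have a: "a > 0" "p - 1 = 1 / a" by (auto simp: a_def)
  then have p: "p = 1 + 1 / a" by simp
  interpret wave_end \<alpha> "\<lambda>t. 1 - u t" "\<lambda>t. - deriv u t" "\<lambda>t. - flux p d u t"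
    "\<lambda>t. f (u t) - c * g (u t)" "\<lambda>t. d (u t)" "\<lambda>t. \<rho> (u t) * d (u t) powr a"
    a \<delta> \<sigma> "k2 * k1 powr a / 2" "2 * (k2 * k1 powr a)" "k1 / 2" "2 * k1" h0
    using wave_end_traveling_wave[OF assms(1-5,7,8)] by (simp add: a_def h0_def \<sigma>_def)
  \<comment> \<open>Since \<open>p - 1 = 1 / a\<close>, the quantity
    \<open>r * (p - 1) + \<delta>\<close> equals \<open>\<sigma> / a\<close>.\<close>
  have \<sigma>_less: "r * (p - 1) + \<delta> < 1 \<longleftrightarrow> \<sigma> < a" "r * (p - 1) + \<delta> > 1 \<longleftrightarrow> \<sigma> > a"
    "r * (p - 1) + \<delta> = 1 \<longleftrightarrow> \<sigma> = a"
    using a(1) unfolding a(2) \<sigma>_def by (auto simp: field_simps)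
  have linear: "a * (1 - \<delta>) < 1 \<longleftrightarrow> p + \<delta> > 2"
    using a(1) unfolding p by (auto simp: field_simps)
  \<comment> \<open>After clearing the denominator the terms \<open>a^2 \<delta>\<close> cancel;
    dividing by \<open>a\<close> then brings in \<open>1 / a = p - 1\<close>.\<close>
  have "a * ((\<sigma> + 1) / (a + 1) - \<delta>) < 1 \<longleftrightarrow> a * (\<sigma> + 1) < (a + 1) * (1 + a * \<delta>)"
    using a(1) by (simp add: field_simps)
  also have "\<dots> \<longleftrightarrow> a * r < a * \<delta> + 1"
    by (simp add: \<sigma>_def algebra_simps)
  also have "\<dots> \<longleftrightarrow> p + \<delta> > r + 1"
    using a(1) unfolding p by (auto simp: field_simps)
  finally have balanced: "a * ((\<sigma> + 1) / (a + 1) - \<delta>) < 1 \<longleftrightarrow> p + \<delta> > r + 1" .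
  have source: "\<sigma> - a * \<delta> = r" by (simp add: \<sigma>_def)
  have \<sigma>_gt: "\<sigma> > a * \<delta>" using assms(6) by (simp add: \<sigma>_def)
  \<comment> \<open>For \<open>\<delta> \<ge> 1\<close> only the regime \<open>\<sigma> > a\<close>
    occurs, as \<open>r > 0\<close>.\<close>
  have \<sigma>_gt_a: "\<sigma> > a" if "\<delta> \<ge> 1"
    using \<sigma>_gt mult_left_mono[OF that, of a] a(1) by linarith
  have lim0: "((deriv u \<circ> real_of_ereal) \<longlongrightarrow> 0) (at_right \<alpha>) \<longleftrightarrow> ((\<lambda>t. - deriv u t) \<longlongrightarrow> 0) ?F"
    unfolding filterlim_at_right_end_iff using tendsto_minus_cancel_left[of "deriv u" 0 ?F] by simp
  have lim_bot: "filterlim (deriv u \<circ> real_of_ereal) at_bot (at_right \<alpha>) \<longleftrightarrow>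
      filterlim (\<lambda>t. - deriv u t) at_top ?F"
    unfolding filterlim_at_right_end_iff using filterlim_uminus_at_bot[of "deriv u"] by simp
  \<comment> \<open>At \<open>\<sigma> = a\<close> the balanced order is 1, so the balanced
    criterion becomes the linear one.\<close>
  have "(a + 1) / (a + 1) = 1" using a(1) by simp
  then have "\<sigma> = a \<longrightarrow> (-\<infinity> < \<alpha> \<longleftrightarrow> p + \<delta> > 2)"
    using finite_end_iff_balanced linear by auto
  moreover have "\<sigma> > a \<and> h0 > 0 \<longrightarrow> (-\<infinity> < \<alpha> \<longleftrightarrow> p + \<delta> > 2)"
    using finite_end_iff_drift linear by auto
  moreover have "\<sigma> > a \<and> h0 < 0 \<longrightarrow> (-\<infinity> < \<alpha> \<longleftrightarrow> r < 1)"
    using finite_end_iff_source source by auto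
  moreover have "\<sigma> > a \<and> r < 1 \<longrightarrow> -\<infinity> < \<alpha>"
    using finite_end_source source by auto
  moreover have "\<sigma> < a \<longrightarrow> (-\<infinity> < \<alpha> \<longleftrightarrow> p + \<delta> > r + 1)"
    using finite_end_iff_balanced balanced by auto
  moreover have "\<delta> < 1 \<longrightarrow> ((\<lambda>t. - deriv u t) \<longlongrightarrow> 0) ?F"
    using v_lim_0_subcritical \<sigma>_gt by blast
  moreover have "\<delta> = 1 \<longrightarrow> (((\<lambda>t. - deriv u t) \<longlongrightarrow> 0) ?F \<longleftrightarrow> h0 \<le> 0)"
    using v_lim_0_critical not_v_lim_0_critical \<sigma>_gt_a by (meson not_le order_refl)
  moreover have "\<delta> > 1 \<and> h0 < 0 \<longrightarrow> ((\<lambda>t. - deriv u t) \<longlongrightarrow> 0) ?F"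
    using v_lim_0_source \<sigma>_gt \<sigma>_gt_a by simp
  moreover have "\<delta> > 1 \<and> h0 > 0 \<longrightarrow> filterlim (\<lambda>t. - deriv u t) at_top ?F"
    using v_lim_at_top_drift by blast
  ultimately show ?thesis
    unfolding \<sigma>_less lim0 lim_bot h0_def by simp
qed

end
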